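(* Let $\varepsilon=(\varepsilon_n)_{n\in\mathbf{Z}}$ be a coin-tossing sequence, and for each $n\in\mathbf{Z}$ let $h_n:\{-1,1\}^{-\mathbf{N}}\to\{-1,1\}$ be measurable. Let $\Phi:\{-1,1\}^{\mathbf{Z}}\to\{-1,1\}^{\mathbf{Z}}$ be defined by $\Phi(x)=(h_n(x_{n-1]})\,x_n)_{n\in\mathbf{Z}}$. Then the conditional law of $\varepsilon$ given $\Phi(\varepsilon)$ is either almost surely diffuse (atomless), or almost surely uniform on a finite set whose cardinality is (almost surely) constant.
   Context: $\mathbf{N}=\{0,1,2,\dots\}$ and $-\mathbf{N}=\{\dots,-2,-1,0\}$. A coin-tossing sequence is a family of independent random variables, each of law $(\delta_{-1}+\delta_1)/2$. For $x=(x_n)_{n\in\mathbf{Z}}\in\{-1,1\}^{\mathbf{Z}}$ and $n\in\mathbf{Z}$, $x_{n]}$ denotes the sequence $(x_{n+k})_{k\in-\mathbf{N}}\in\{-1,1\}^{-\mathbf{N}}$. Product spaces carry their product $\sigma$-fields. The conditional law is a regular conditional distribution. *)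

theory Defs
  imports "HOL-Probability.Probability"
begin

abbreviation coin :: "int measure"
  where "coin \<equiv> count_space {-1, 1}"

definition two_sided :: "(int \<Rightarrow> int) measure"
  where "two_sided = (\<Pi>\<^sub>M n\<in>UNIV. coin)"

definition one_sided :: "(int \<Rightarrow> int) measure"
  where "one_sided = (\<Pi>\<^sub>M k\<in>{..0}. coin)"

text \<open>The sequence \<open>x\<^bsub>n]\<^esub>\<close>, an extensional function on the nonpositive integers.\<close>

definition past :: "(int \<Rightarrow> int) \<Rightarrow> int \<Rightarrow> (int \<Rightarrow> int)"
  where "past x n = (\<lambda>k\<in>{..0}. x (n + k))"

definition Phi :: "(int \<Rightarrow> (int \<Rightarrow> int) \<Rightarrow> int) \<Rightarrow> (int \<Rightarrow> int) \<Rightarrow> (int \<Rightarrow> int)"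
  where "Phi h x = (\<lambda>n. h n (past x (n - 1)) * x n)"

definition coin_tossing :: "'a measure \<Rightarrow> (int \<Rightarrow> 'a \<Rightarrow> int) \<Rightarrow> bool"
  where "coin_tossing M \<epsilon> \<longleftrightarrow>
    prob_space.indep_vars M (\<lambda>_. coin) \<epsilon> UNIV \<and>
    (\<forall>n. distr M coin (\<epsilon> n) = uniform_count_measure {-1, 1})"

text \<open>\<open>K\<close> is a version of the regular conditional distribution of the \<open>N\<close>-valued random
  variable \<open>X\<close> given the \<open>S\<close>-valued random variable \<open>Y\<close>: a probability kernel that is
  measurable for the \<open>\<sigma>\<close>-field generated by \<open>Y\<close>.\<close>

definition regular_cond_law ::
  "'a measure \<Rightarrow> ('a \<Rightarrow> 'b) \<Rightarrow> 'b measure \<Rightarrow> ('a \<Rightarrow> 'c) \<Rightarrow> 'c measure \<Rightarrow> ('a \<Rightarrow> 'b measure) \<Rightarrow> bool"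
  where "regular_cond_law M X N Y S K \<longleftrightarrow>
    K \<in> vimage_algebra (space M) Y S \<rightarrow>\<^sub>M prob_algebra N \<and>
    (\<forall>B\<in>sets N. AE \<omega> in M. measure (K \<omega>) B =
       real_cond_exp M (vimage_algebra (space M) Y S) (indicator (X -` B \<inter> space M)) \<omega>)"

text \<open>Meaningful only when singletons are measurable, as in \<open>two_sided\<close> by the next lemma.\<close>

definition diffuse :: "'b measure \<Rightarrow> bool"
  where "diffuse \<mu> \<longleftrightarrow> (\<forall>x\<in>space \<mu>. emeasure \<mu> {x} = 0)"

lemma sets_two_sided_singleton:
  assumes "x \<in> space two_sided"
  shows "{x} \<in> sets two_sided"
proof -
  have "{x} = (\<Pi>\<^sub>E n\<in>UNIV. {x n})"
    by (auto simp: PiE_def Pi_def)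
  also have "\<dots> \<in> sets (\<Pi>\<^sub>M n\<in>UNIV. coin)"
    using assms by (intro sets_PiM_I_countable) (auto simp: two_sided_def space_PiM PiE_def Pi_def)
  finally show ?thesis by (simp add: two_sided_def)
qed

text \<open>The uniform law on \<open>F\<close>, pushed forward to the ambient space \<open>N\<close> by inclusion.\<close>

definition uniform_law_on :: "'b measure \<Rightarrow> 'b set \<Rightarrow> 'b measure"
  where "uniform_law_on N F = distr (uniform_count_measure F) N (\<lambda>x. x)"

end

theory Submission
  imports Defs
begin

text \<open>
  Write \<open>\<epsilon>\<close> for the input and \<open>\<eta>\<close> for the output \<open>Phi h \<epsilon>\<close>, and let \<open>f\<close> be the mass that the
  conditional law of \<open>\<epsilon>\<close> given \<open>\<eta>\<close> gives to the true input \<open>\<epsilon>\<close>. It is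
  enough that \<open>f\<close> is almost surely constant. Indeed, given the output, the true input is a typical point of its
  conditional law (\<open>regular_cond_law_AE_AE\<close>), so if \<open>f = c\<close> almost surely then almost
  every point of the conditional law has mass \<open>c\<close>. If \<open>c = 0\<close> there is no atom
  (\<open>diffuse_if_AE_atoms_null\<close>); if \<open>c > 0\<close> the law is uniform on \<open>1 / c\<close> points
  (\<open>uniform_law_on_if_AE_atoms_equal\<close>).

  Constancy of \<open>f\<close> is an instance of Kolmogorov's zero-one law. Fix a time \<open>n\<close>. The input can be
  recovered from the output and from the input up to time \<open>n\<close>
  (\<open>eq_if_same_past_and_Phi\<close>), so \<open>f\<close> is also the mass given to the set of sequences that agree with \<open>\<epsilon>\<close>
  up to time \<open>n\<close>. That mass involves only conditional probabilities of events of the input up to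
  time \<open>n\<close>. The output after time \<open>n\<close> is independent of the input up to time \<open>n\<close>, since each
  \<open>\<epsilon> k\<close> is symmetric and independent of the sign that multiplies it (\<open>eta_future_indep\<close>). Hence these
  conditional probabilities given the whole output depend on the output up to time \<open>n\<close> alone
  (\<open>cond_exp_output_eq_cond_exp_past\<close>), and that part of the output is a function of the input up to
  time \<open>n\<close>. So \<open>f\<close> is, up to a null set, a function of the input up to time \<open>n\<close>; as \<open>n\<close> is
  arbitrary, \<open>f\<close> is almost surely constant (\<open>tail_measurable_AE_const\<close>).
\<close>

section \<open>Conditional expectation and independence\<close>

lemma subalgebra_trans: "subalgebra M F \<Longrightarrow> subalgebra F G \<Longrightarrow> subalgebra M G"
  by (auto simp: subalgebra_def)

context prob_space
begin

lemma finite_measure_subalgebraI: "subalgebra M F \<Longrightarrow> finite_measure_subalgebra M F"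
  by (simp add: finite_measure_subalgebra_def finite_measure_subalgebra_axioms_def
      finite_measure_axioms)

text \<open>The conditional expectation of the indicator of \<open>B\<close> given \<open>F\<close> is constant, so the
  factorisation of probabilities extends from events of \<open>F\<close> to integrable functions without
  any approximation by simple functions.\<close>

lemma integral_mult_indicator_indep:
  fixes u :: "'a \<Rightarrow> real"
  assumes F: "subalgebra M F" and B: "B \<in> events"
    and indep: "\<And>D. D \<in> sets F \<Longrightarrow> prob (D \<inter> B) = prob D * prob B"
    and u: "u \<in> borel_measurable F" "integrable M u"
  shows "(\<integral>\<omega>. u \<omega> * indicator B \<omega> \<partial>M) = prob B * (\<integral>\<omega>. u \<omega> \<partial>M)"
proof -
  interpret F: finite_measure_subalgebra M F
    using F by (rule finite_measure_subalgebraI)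
  have ce: "AE \<omega> in M. real_cond_exp M F (indicator B) \<omega> = prob B"
  proof (rule F.real_cond_exp_charact)
    fix D assume D: "D \<in> sets F"
    then have DM: "D \<in> events" using F by (auto simp: subalgebra_def)
    have "(\<integral>x\<in>D. indicator B x \<partial>M) = (\<integral>x. indicator (D \<inter> B) x \<partial>M)"
      unfolding set_lebesgue_integral_def
      by (intro Bochner_Integration.integral_cong) (auto simp: indicator_def)
    also have "\<dots> = prob (D \<inter> B)" using DM B by simp
    also have "\<dots> = (\<integral>x\<in>D. prob B \<partial>M)"
      unfolding set_lebesgue_integral_def using DM indep[OF D] by simp
    finally show "(\<integral>x\<in>D. indicator B x \<partial>M) = (\<integral>x\<in>D. prob B \<partial>M)" .
  qed (use B in \<open>auto simp: integrable_indicator_iff less_top[symmetric]\<close>)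
  have int: "integrable M (\<lambda>\<omega>. u \<omega> * indicator B \<omega>)"
    using integrable_real_mult_indicator[OF B u(2)] by (simp add: mult.commute)
  have [measurable]: "u \<in> borel_measurable M"
    using u(2) by auto
  have "(\<integral>\<omega>. u \<omega> * indicator B \<omega> \<partial>M) = (\<integral>\<omega>. u \<omega> * real_cond_exp M F (indicator B) \<omega> \<partial>M)"
    using F.real_cond_exp_intg(2)[OF int u(1)] B by simp
  also have "\<dots> = (\<integral>\<omega>. u \<omega> * prob B \<partial>M)"
    by (rule integral_cong_AE) (use ce in \<open>auto simp: measurable_from_subalg[OF F]\<close>)
  finally show ?thesis by simp
qed

text \<open>If \<open>H\<close> is generated by \<open>G\<close> together with further events that are independent of a field \<open>F\<close> containing
  \<open>G\<close>, then these further events are of no help in predicting \<open>F\<close>. On a generator \<open>A \<inter> B\<close> of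
  \<open>H\<close>, with \<open>A\<close> in \<open>G\<close> and \<open>B\<close> independent of \<open>F\<close>, the integrals of \<open>f\<close> and of its conditional
  expectation given \<open>G\<close> are those over \<open>A\<close>, both multiplied by the probability of \<open>B\<close>.\<close>

lemma real_cond_exp_drop_independent:
  fixes f :: "'a \<Rightarrow> real"
  assumes F: "subalgebra M F" and GF: "subalgebra F G"
    and H: "subalgebra M H" and GH: "subalgebra H G"
    and gen: "sets H = sigma_sets (space M) P" and P: "Int_stable P" "P \<subseteq> Pow (space M)"
    and split: "\<And>C. C \<in> P \<Longrightarrow> \<exists>A\<in>sets G. \<exists>B\<in>events. C = A \<inter> B \<and>
      (\<forall>D\<in>sets F. prob (D \<inter> B) = prob D * prob B)"
    and f: "f \<in> borel_measurable F" "integrable M f"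
  shows "AE \<omega> in M. real_cond_exp M H f \<omega> = real_cond_exp M G f \<omega>"
proof -
  have G: "subalgebra M G" using F GF by (rule subalgebra_trans)
  interpret G: finite_measure_subalgebra M G
    using G by (rule finite_measure_subalgebraI)
  interpret H: finite_measure_subalgebra M H
    using H by (rule finite_measure_subalgebraI)
  let ?g = "real_cond_exp M G f"
  have gG: "?g \<in> borel_measurable G" by simp
  have gI: "integrable M ?g" using G.real_cond_exp_int(1)[OF f(2)] .
  have gF: "?g \<in> borel_measurable F" using measurable_from_subalg[OF GF gG] .
  have gH: "?g \<in> borel_measurable H" using measurable_from_subalg[OF GH gG] .
  have HM: "sets H \<subseteq> events" using H by (auto simp: subalgebra_def)
  have GM: "sets G \<subseteq> events" using G by (auto simp: subalgebra_def)
  have GF': "sets G \<subseteq> sets F" using GF by (auto simp: subalgebra_def)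
  have set_int: "set_integrable M A u" if "A \<in> events" "integrable M u" for A and u :: "'a \<Rightarrow> real"
    unfolding set_integrable_def using integrable_mult_indicator[OF that] .
  have eq: "(\<integral>x\<in>C. f x \<partial>M) = (\<integral>x\<in>C. ?g x \<partial>M)" if "C \<in> sigma_sets (space M) P" for C
    using P that
  proof (induction rule: sigma_sets_induct_disjoint)
    case (basic C)
    then obtain A B where A: "A \<in> sets G" and B: "B \<in> events" and C: "C = A \<inter> B"
      and indep: "\<And>D. D \<in> sets F \<Longrightarrow> prob (D \<inter> B) = prob D * prob B"
      using split by metis
    have AF: "A \<in> sets F" using A GF' by auto
    have AM: "A \<in> events" using A GM by auto
    have *: "(\<integral>x\<in>C. u x \<partial>M) = prob B * (\<integral>x\<in>A. u x \<partial>M)"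
      if u: "u \<in> borel_measurable F" "integrable M u" for u :: "'a \<Rightarrow> real"
    proof -
      have "(\<integral>x\<in>C. u x \<partial>M) = (\<integral>x. (indicator A x * u x) * indicator B x \<partial>M)"
        unfolding set_lebesgue_integral_def C
        by (intro Bochner_Integration.integral_cong) (auto simp: indicator_def)
      also have "\<dots> = prob B * (\<integral>x. indicator A x * u x \<partial>M)"
      proof (rule integral_mult_indicator_indep[OF F B indep])
        show "(\<lambda>x. indicator A x * u x) \<in> borel_measurable F"
          using u(1) AF by measurable
        show "integrable M (\<lambda>x. indicator A x * u x)"
          using integrable_mult_indicator[OF AM u(2)] by simp
      qed
      finally show ?thesis by (simp add: set_lebesgue_integral_def)
    qed
    show ?case
      unfolding *[OF f] *[OF gF gI] using G.real_cond_exp_intA[OF f(2) A] by simp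
  next
    case empty
    show ?case by (simp add: set_lebesgue_integral_def)
  next
    case (compl C)
    then have C: "C \<in> events" using gen HM by auto
    have *: "(\<integral>x\<in>space M - C. u x \<partial>M) = (\<integral>x. u x \<partial>M) - (\<integral>x\<in>C. u x \<partial>M)"
      if "integrable M u" for u :: "'a \<Rightarrow> real"
    proof -
      have "(\<integral>x\<in>(space M - C) \<union> C. u x \<partial>M) = (\<integral>x\<in>space M - C. u x \<partial>M) + (\<integral>x\<in>C. u x \<partial>M)"
        by (rule set_integral_Un) (use that C in \<open>auto intro!: set_int\<close>)
      moreover have "(space M - C) \<union> C = space M" using sets.sets_into_space[OF C] by auto
      ultimately show ?thesis using set_integral_space[OF that] by simp
    qed
    show ?case
      unfolding *[OF f(2)] *[OF gI] using compl.IH G.real_cond_exp_int(2)[OF f(2)] by simp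
  next
    case (union C)
    then have C: "\<And>i. C i \<in> events" using gen HM by auto
    have "(\<integral>x\<in>(\<Union>i. C i). u x \<partial>M) = (\<Sum>i. (\<integral>x\<in>C i. u x \<partial>M))"
      if "integrable M u" for u :: "'a \<Rightarrow> real"
      using C union.hyps(1)
      by (intro lebesgue_integral_countable_add set_int that) (auto simp: disjoint_family_on_def)
    then show ?case using f(2) gI union.IH by simp
  qed
  show ?thesis
    by (rule H.real_cond_exp_charact) (use eq gen f gI gH in auto)
qed

section \<open>A zero-one law\<close>

lemma indep_sets_reindex:
  assumes indep: "indep_sets A UNIV" and f: "inj f"
  shows "indep_sets (\<lambda>i. A (f i)) UNIV"
proof (rule indep_setsI)
  show "A (f i) \<subseteq> events" for i
    using indep by (auto simp: indep_sets_def)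
  fix B J assume J: "J \<noteq> {}" "finite J" and B: "\<forall>j\<in>J. B j \<in> A (f j)"
  have "prob (\<Inter>k\<in>f ` J. B (inv f k)) = (\<Prod>k\<in>f ` J. prob (B (inv f k)))"
    using J B by (intro indep_setsD[OF indep]) (auto simp: inv_f_f[OF f])
  then show "prob (\<Inter>j\<in>J. B j) = (\<Prod>j\<in>J. prob (B j))"
    by (simp add: image_image inv_f_f[OF f] prod.reindex[OF inj_on_subset[OF f]])
qed

text \<open>Kolmogorov's law for a function that need not be tail measurable but has, for every \<open>m\<close>, a
  version \<open>g m\<close> depending on the coordinates from \<open>m\<close> on only. The versions agree only
  up to null sets, so an event \<open>{f > q}\<close> is replaced by ``eventually \<open>g m > q\<close>'', which is a genuine tail
  event and agrees with it almost surely.\<close>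

lemma tail_measurable_AE_const:
  fixes f :: "'a \<Rightarrow> real" and A :: "nat \<Rightarrow> 'a set set"
  assumes alg: "\<And>i. sigma_algebra (space M) (A i)" and indep: "indep_sets A UNIV"
    and meas: "\<And>m. g m \<in> borel_measurable (sigma (space M) (\<Union>i\<in>{m..}. A i))"
    and eq: "\<And>m. AE \<omega> in M. f \<omega> = g m \<omega>"
  shows "\<exists>c. AE \<omega> in M. f \<omega> = c"
proof -
  have sub: "(\<Union>i\<in>{m..}. A i) \<subseteq> Pow (space M)" for m
    using alg unfolding sigma_algebra_iff2 by blast
  have AEeq: "AE \<omega> in M. \<forall>m. f \<omega> = g m \<omega>"
    using eq by (simp add: AE_all_countable)
  have A_ev: "A i \<subseteq> events" for i
    using indep by (auto simp: indep_sets_def)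
  have zero_one: "(AE \<omega> in M. f \<omega> > q) \<or> (AE \<omega> in M. f \<omega> \<le> q)" for q
  proof -
    define E where "E = {\<omega>\<in>space M. \<exists>N. \<forall>m\<ge>N. g m \<omega> > q}"
    have "E \<in> tail_events A"
      unfolding tail_events_def
    proof
      fix n
      let ?S = "sigma (space M) (\<Union>i\<in>{n..}. A i)"
      \<comment> \<open>Dropping the first \<open>n\<close> versions does not change the event, and the others depend only on
        the coordinates from \<open>n\<close> on.\<close>
      have shift: "E = {\<omega>\<in>space M. \<exists>N. \<forall>m\<ge>N. g (n + m) \<omega> > q}"
      proof -
        have "(\<exists>N. \<forall>m\<ge>N. g m \<omega> > q) \<longleftrightarrow> (\<exists>N. \<forall>m\<ge>N. g (n + m) \<omega> > q)" for \<omega>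
          using eventually_sequentially_seg[of "\<lambda>m. g m \<omega> > q" n]
          by (simp add: eventually_sequentially add.commute)
        then show ?thesis by (simp add: E_def)
      qed
      have [measurable]: "g (n + m) \<in> borel_measurable ?S" for m
      proof (rule measurable_from_subalg[OF _ meas])
        have "(\<Union>i\<in>{n+m..}. A i) \<subseteq> (\<Union>i\<in>{n..}. A i)" by fastforce
        then show "subalgebra ?S (sigma (space M) (\<Union>i\<in>{n+m..}. A i))"
          using sub by (auto simp: subalgebra_def sigma_sets_mono' intro: subsetD[OF sigma_sets_mono'])
      qed
      have "{\<omega>\<in>space ?S. \<exists>N. \<forall>m\<ge>N. g (n + m) \<omega> > q} \<in> sets ?S"
        by measurable
      then show "E \<in> sigma_sets (space M) (\<Union> (A ` {n..}))"
        using sub by (simp add: shift)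
    qed
    then have "prob E = 0 \<or> prob E = 1" and E: "E \<in> events"
      using kolmogorov_0_1_law[OF alg indep] tail_events_sets[of A, OF A_ev] by auto
    moreover have E_iff: "AE \<omega> in M. \<omega> \<in> E \<longleftrightarrow> f \<omega> > q"
      using AEeq AE_space by eventually_elim (auto simp: E_def)
    ultimately consider "AE \<omega> in M. \<omega> \<notin> E" | "AE \<omega> in M. \<omega> \<in> E"
      using prob_eq_0[OF E] AE_prob_1[of E] by auto
    then show ?thesis
    proof cases
      case 1
      then have "AE \<omega> in M. f \<omega> \<le> q" using E_iff by eventually_elim auto
      then show ?thesis ..
    next
      case 2
      then have "AE \<omega> in M. f \<omega> > q" using E_iff by eventually_elim auto
      then show ?thesis ..
    qed
  qed
  \<comment> \<open>Every threshold is almost surely exceeded or almost surely not, and the value of \<open>f\<close> is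
    the cut between the two kinds.\<close>
  define L where "L = {q. AE \<omega> in M. f \<omega> > q}"
  have down: "q \<in> L" if "q' \<in> L" "q \<le> q'" for q q'
    using that(1) unfolding L_def mem_Collect_eq by eventually_elim (use that(2) in auto)
  have above: "\<exists>b. b \<notin> L"
  proof (rule ccontr)
    assume "\<not> ?thesis"
    then have "AE \<omega> in M. \<forall>n::nat. f \<omega> > real n"
      by (auto simp: L_def AE_all_countable)
    then have "AE \<omega> in M. False"
      by eventually_elim (meson reals_Archimedean2 less_asym)
    then show False by simp
  qed
  have below: "L \<noteq> {}"
  proof
    assume "L = {}"
    then have "AE \<omega> in M. f \<omega> \<le> - real n" for n
      using zero_one[of "- real n"] by (auto simp: L_def)
    then have "AE \<omega> in M. \<forall>n::nat. f \<omega> \<le> - real n"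
      by (auto simp: AE_all_countable)
    then have "AE \<omega> in M. False"
      by eventually_elim (metis reals_Archimedean2 minus_le_iff neg_le_iff_le not_le le_minus_iff)
    then show False by simp
  qed
  obtain b where b: "b \<notin> L" using above by auto
  have bdd: "bdd_above L"
    by (rule bdd_aboveI[of _ b]) (use b down in \<open>meson linear\<close>)
  have "AE \<omega> in M. f \<omega> > Sup L - 1 / real (Suc n)" for n
  proof -
    obtain q where "q \<in> L" "Sup L - 1 / real (Suc n) < q"
      using less_cSup_iff[OF below bdd, of "Sup L - 1 / real (Suc n)"] by auto
    then have "Sup L - 1 / real (Suc n) \<in> L" using down by auto
    then show ?thesis by (simp add: L_def)
  qed
  moreover have "AE \<omega> in M. f \<omega> \<le> Sup L + 1 / real (Suc n)" for n
  proof -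
    have "Sup L + 1 / real (Suc n) \<notin> L"
      using cSup_upper[OF _ bdd, of "Sup L + 1 / real (Suc n)"] by auto
    then show ?thesis using zero_one by (auto simp: L_def)
  qed
  ultimately have "AE \<omega> in M. \<forall>n. f \<omega> > Sup L - 1 / real (Suc n) \<and> f \<omega> \<le> Sup L + 1 / real (Suc n)"
    by (simp add: AE_all_countable)
  then have "AE \<omega> in M. f \<omega> = Sup L"
  proof eventually_elim
    case (elim \<omega>)
    have "\<bar>f \<omega> - Sup L\<bar> \<le> e" if "e > 0" for e
    proof -
      obtain n where "1 / real (Suc n) < e"
        using reals_Archimedean[OF \<open>e > 0\<close>] by (auto simp: inverse_eq_divide)
      then show ?thesis using elim[rule_format, of n] by linarith
    qed
    then have "\<bar>f \<omega> - Sup L\<bar> \<le> 0" by (rule field_le_epsilon[of _ 0, simplified])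
    then show ?case by simp
  qed
  then show ?thesis ..
qed

end

section \<open>Regular conditional laws\<close>

lemma subalgebra_vimage_algebra:
  assumes "Y \<in> M \<rightarrow>\<^sub>M S"
  shows "subalgebra M (vimage_algebra (space M) Y S)"
proof -
  have "Y \<in> space M \<rightarrow> space S" using measurable_space[OF assms] by auto
  then show ?thesis
    using measurable_sets[OF assms] by (auto simp: subalgebra_def sets_vimage_algebra2)
qed

text \<open>By definition the kernel gives the conditional probability of \<open>{X \<in> B}\<close> for a fixed \<open>B\<close>. Here
  the set may vary measurably with the conditioning variable; on rectangles this is the
  definition, and rectangles generate.\<close>

lemma regular_cond_law_disintegration:
  assumes "prob_space M" and X: "X \<in> M \<rightarrow>\<^sub>M N" and Y: "Y \<in> M \<rightarrow>\<^sub>M S"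
    and K: "regular_cond_law M X N Y S K"
    and Q: "Q \<in> sets (vimage_algebra (space M) Y S \<Otimes>\<^sub>M N)"
  shows "emeasure M {\<omega>\<in>space M. (\<omega>, X \<omega>) \<in> Q} = (\<integral>\<^sup>+\<omega>. emeasure (K \<omega>) (Pair \<omega> -` Q) \<partial>M)"
proof -
  interpret prob_space M by fact
  let ?H = "vimage_algebra (space M) Y S"
  have H: "subalgebra M ?H"
    using Y by (rule subalgebra_vimage_algebra)
  interpret H: finite_measure_subalgebra M ?H
    using H by (rule finite_measure_subalgebraI)
  have idH: "(\<lambda>\<omega>. \<omega>) \<in> M \<rightarrow>\<^sub>M ?H"
    by (rule measurable_from_subalg[OF H measurable_ident_sets[OF refl]])
  have K_meas: "K \<in> ?H \<rightarrow>\<^sub>M prob_algebra N"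
    and K_ce: "\<And>B. B \<in> sets N \<Longrightarrow> AE \<omega> in M. measure (K \<omega>) B =
       real_cond_exp M ?H (indicator (X -` B \<inter> space M)) \<omega>"
    using K by (auto simp: regular_cond_law_def)
  have K_sub: "K \<in> ?H \<rightarrow>\<^sub>M subprob_algebra N" using K_meas by (rule measurable_prob_algebraD)
  have K_prob: "prob_space (K \<omega>)" and K_sets: "sets (K \<omega>) = sets N" if "\<omega> \<in> space M" for \<omega>
    using measurable_space[OF K_meas, of \<omega>] that by (auto simp: space_prob_algebra)
  have pair: "(\<lambda>\<omega>. (\<omega>, X \<omega>)) \<in> M \<rightarrow>\<^sub>M ?H \<Otimes>\<^sub>M N"
    using idH X by (rule measurable_Pair)
  have evH: "(\<lambda>\<omega>. emeasure (K \<omega>) (Pair \<omega> -` R)) \<in> borel_measurable ?H"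
    if "R \<in> sets (?H \<Otimes>\<^sub>M N)" for R
  proof (rule emeasure_measurable_subprob_algebra2[OF _ K_sub])
    have "(SIGMA \<omega>:space ?H. Pair \<omega> -` R) = R"
      using sets.sets_into_space[OF that] by (auto simp: space_pair_measure)
    then show "(SIGMA \<omega>:space ?H. Pair \<omega> -` R) \<in> sets (?H \<Otimes>\<^sub>M N)" using that by simp
  qed
  have ev: "(\<lambda>\<omega>. emeasure (K \<omega>) (Pair \<omega> -` R)) \<in> borel_measurable M"
    if "R \<in> sets (?H \<Otimes>\<^sub>M N)" for R
    using measurable_from_subalg[OF H evH[OF that]] .
  have slice: "Pair \<omega> -` R \<in> sets N" if "R \<in> sets (?H \<Otimes>\<^sub>M N)" for \<omega> R
    using sets_Pair1[OF that] .
  let ?G = "{a \<times> b | a b. a \<in> sets ?H \<and> b \<in> sets N}"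
  let ?\<Omega> = "space ?H \<times> space N"
  have G: "?G \<subseteq> Pow ?\<Omega>" by (rule pair_measure_closed)
  have sets_eq: "sets (?H \<Otimes>\<^sub>M N) = sigma_sets ?\<Omega> ?G"
    by (rule sets_pair_measure)
  have "Q \<in> sigma_sets ?\<Omega> ?G" using Q sets_eq by simp
  from Int_stable_pair_measure_generator[of ?H N] G this show ?thesis
  proof (induction rule: sigma_sets_induct_disjoint)
    case (basic R)
    then obtain A B where R: "R = A \<times> B" and A: "A \<in> sets ?H" and B: "B \<in> sets N" by blast
    have AM: "A \<in> events" using A H by (auto simp: subalgebra_def)
    let ?E = "X -` B \<inter> space M"
    have E: "?E \<in> events" using X B by (rule measurable_sets)
    have K1: "integrable M (\<lambda>\<omega>. measure (K \<omega>) B)"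
    proof (rule integrable_const_bound[of _ 1])
      show "AE \<omega> in M. norm (measure (K \<omega>) B) \<le> 1"
        using K_prob by (auto intro!: AE_I2 prob_space.prob_le_1)
      show "(\<lambda>\<omega>. measure (K \<omega>) B) \<in> borel_measurable M"
        by (rule measurable_from_subalg[OF H]) (use K_meas B in measurable)
    qed
    have "emeasure M {\<omega>\<in>space M. (\<omega>, X \<omega>) \<in> R} = emeasure M (A \<inter> ?E)"
      using sets.sets_into_space[OF AM] by (intro arg_cong[where f = "emeasure M"]) (auto simp: R)
    also have "\<dots> = ennreal (\<integral>x\<in>A. indicat_real ?E x \<partial>M)"
    proof -
      have "(\<integral>x\<in>A. indicat_real ?E x \<partial>M) = (\<integral>x. indicat_real (A \<inter> ?E) x \<partial>M)"
        unfolding set_lebesgue_integral_def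
        by (intro Bochner_Integration.integral_cong) (auto simp: indicator_def)
      then show ?thesis using AM E by (simp add: emeasure_eq_measure)
    qed
    also have "(\<integral>x\<in>A. indicat_real ?E x \<partial>M) = (\<integral>x\<in>A. real_cond_exp M ?H (indicator ?E) x \<partial>M)"
      using A E by (intro H.real_cond_exp_intA)
        (simp_all add: integrable_indicator_iff less_top[symmetric] del: sets_vimage_algebra)
    also have "\<dots> = (\<integral>x\<in>A. measure (K x) B \<partial>M)"
      unfolding set_lebesgue_integral_def
    proof (rule integral_cong_AE)
      have iA: "(indicator A :: 'a \<Rightarrow> real) \<in> borel_measurable M" using AM by simp
      show "(\<lambda>x. indicator A x *\<^sub>R measure (K x) B) \<in> borel_measurable M"
        using iA borel_measurable_integrable[OF K1] by (rule borel_measurable_scaleR)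
      show "(\<lambda>x. indicator A x *\<^sub>R real_cond_exp M ?H (indicator ?E) x) \<in> borel_measurable M"
        using iA borel_measurable_cond_exp2 by (rule borel_measurable_scaleR)
      show "AE x in M. indicator A x *\<^sub>R real_cond_exp M ?H (indicator ?E) x
          = indicator A x *\<^sub>R measure (K x) B"
        using K_ce[OF B] by eventually_elim simp
    qed
    also have "ennreal \<dots> = (\<integral>\<^sup>+x. ennreal (indicator A x * measure (K x) B) \<partial>M)"
      unfolding set_lebesgue_integral_def
      by (subst nn_integral_eq_integral) (use integrable_mult_indicator[OF AM K1] in auto)
    also have "\<dots> = (\<integral>\<^sup>+\<omega>. emeasure (K \<omega>) (Pair \<omega> -` R) \<partial>M)"
    proof (rule nn_integral_cong)
      fix \<omega> assume \<omega>: "\<omega> \<in> space M"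
      interpret K: prob_space "K \<omega>" using K_prob[OF \<omega>] .
      have "Pair \<omega> -` R = (if \<omega> \<in> A then B else {})" by (auto simp: R)
      then show "ennreal (indicator A \<omega> * measure (K \<omega>) B) = emeasure (K \<omega>) (Pair \<omega> -` R)"
        by (simp add: K.emeasure_eq_measure)
    qed
    finally show ?case .
  next
    case empty
    show ?case by simp
  next
    case (compl R)
    then have R: "R \<in> sets (?H \<Otimes>\<^sub>M N)" by (simp add: sets_eq)
    let ?R = "{\<omega>\<in>space M. (\<omega>, X \<omega>) \<in> R}"
    have RM: "?R \<in> events" using measurable_sets[OF pair R] by (simp add: vimage_def Int_def conj_commute)
    have le: "emeasure (K \<omega>) (Pair \<omega> -` R) \<le> 1" if "\<omega> \<in> space M" for \<omega>
      using prob_space.emeasure_le_1[OF K_prob[OF that]] .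
    have "emeasure M {\<omega>\<in>space M. (\<omega>, X \<omega>) \<in> ?\<Omega> - R} = emeasure M (space M - ?R)"
      using measurable_space[OF X] by (intro arg_cong[where f = "emeasure M"]) auto
    also have "\<dots> = 1 - emeasure M ?R"
      using RM by (subst emeasure_compl) (auto simp: emeasure_space_1)
    also have "\<dots> = (\<integral>\<^sup>+\<omega>. 1 \<partial>M) - (\<integral>\<^sup>+\<omega>. emeasure (K \<omega>) (Pair \<omega> -` R) \<partial>M)"
      by (simp add: compl.IH emeasure_space_1)
    also have "\<dots> = (\<integral>\<^sup>+\<omega>. 1 - emeasure (K \<omega>) (Pair \<omega> -` R) \<partial>M)"
      by (rule nn_integral_diff[symmetric])
        (use le ev[OF R] compl.IH[symmetric] emeasure_finite[of ?R] in \<open>auto intro!: AE_I2\<close>)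
    also have "\<dots> = (\<integral>\<^sup>+\<omega>. emeasure (K \<omega>) (Pair \<omega> -` (?\<Omega> - R)) \<partial>M)"
    proof (rule nn_integral_cong)
      fix \<omega> assume \<omega>: "\<omega> \<in> space M"
      interpret K: prob_space "K \<omega>" using K_prob[OF \<omega>] .
      have "Pair \<omega> -` (?\<Omega> - R) = space (K \<omega>) - Pair \<omega> -` R"
        using \<omega> by (auto simp: sets_eq_imp_space_eq[OF K_sets[OF \<omega>]])
      then show "1 - emeasure (K \<omega>) (Pair \<omega> -` R) = emeasure (K \<omega>) (Pair \<omega> -` (?\<Omega> - R))"
        using slice[OF R] K_sets[OF \<omega>]
        by (simp add: emeasure_compl K.emeasure_space_1)
    qed
    finally show ?case .
  next
    case (union R)
    then have R: "\<And>i. R i \<in> sets (?H \<Otimes>\<^sub>M N)" by (auto simp: sets_eq)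
    let ?R = "\<lambda>i. {\<omega>\<in>space M. (\<omega>, X \<omega>) \<in> R i}"
    have RM: "?R i \<in> events" for i
      using measurable_sets[OF pair R] by (simp add: vimage_def Int_def conj_commute)
    have "emeasure M {\<omega>\<in>space M. (\<omega>, X \<omega>) \<in> (\<Union>i. R i)} = emeasure M (\<Union>i. ?R i)"
      by (intro arg_cong[where f = "emeasure M"]) auto
    also have "\<dots> = (\<Sum>i. emeasure M (?R i))"
      using RM union.hyps(1)
      by (intro suminf_emeasure[symmetric]) (auto simp: disjoint_family_on_def)
    also have "\<dots> = (\<Sum>i. \<integral>\<^sup>+\<omega>. emeasure (K \<omega>) (Pair \<omega> -` R i) \<partial>M)"
      by (simp add: union.IH)
    also have "\<dots> = (\<integral>\<^sup>+\<omega>. (\<Sum>i. emeasure (K \<omega>) (Pair \<omega> -` R i)) \<partial>M)"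
      by (rule nn_integral_suminf[symmetric]) (rule ev[OF R])
    also have "\<dots> = (\<integral>\<^sup>+\<omega>. emeasure (K \<omega>) (Pair \<omega> -` (\<Union>i. R i)) \<partial>M)"
    proof (rule nn_integral_cong)
      fix \<omega> assume \<omega>: "\<omega> \<in> space M"
      have "disjoint_family (\<lambda>i. Pair \<omega> -` R i)"
        using union.hyps(1) by (simp add: disjoint_family_on_def vimage_Int[symmetric])
      then have "(\<Sum>i. emeasure (K \<omega>) (Pair \<omega> -` R i)) = emeasure (K \<omega>) (\<Union>i. Pair \<omega> -` R i)"
        using slice[OF R] K_sets[OF \<omega>] by (intro suminf_emeasure) auto
      then show "(\<Sum>i. emeasure (K \<omega>) (Pair \<omega> -` R i)) = emeasure (K \<omega>) (Pair \<omega> -` (\<Union>i. R i))"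
        by (simp add: vimage_UN)
    qed
    finally show ?case .
  qed
qed

text \<open>What holds almost surely for the variable itself holds for almost every point drawn from its
  conditional law. The property may refer to the conditional law, because that is measurable for
  the conditioning field; this is what makes it possible to speak about the mass of a random atom.\<close>

lemma regular_cond_law_AE_AE:
  assumes "prob_space M" and X: "X \<in> M \<rightarrow>\<^sub>M N" and Y: "Y \<in> M \<rightarrow>\<^sub>M S"
    and K: "regular_cond_law M X N Y S K"
    and Q: "{z \<in> space (vimage_algebra (space M) Y S \<Otimes>\<^sub>M N). P (fst z) (snd z)}
      \<in> sets (vimage_algebra (space M) Y S \<Otimes>\<^sub>M N)"
    and AE: "AE \<omega> in M. P \<omega> (X \<omega>)"
  shows "AE \<omega> in M. AE x in K \<omega>. P \<omega> x"
proof -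
  interpret prob_space M by fact
  let ?HN = "vimage_algebra (space M) Y S \<Otimes>\<^sub>M N"
  let ?Q = "{z \<in> space ?HN. P (fst z) (snd z)}"
  let ?D = "space ?HN - ?Q"
  have D: "?D \<in> sets ?HN" using Q by auto
  have K_meas: "K \<in> vimage_algebra (space M) Y S \<rightarrow>\<^sub>M prob_algebra N"
    using K by (auto simp: regular_cond_law_def)
  have K_sets: "sets (K \<omega>) = sets N" if "\<omega> \<in> space M" for \<omega>
    using measurable_space[OF K_meas, of \<omega>] that by (auto simp: space_prob_algebra)
  have H: "subalgebra M (vimage_algebra (space M) Y S)"
    using Y by (rule subalgebra_vimage_algebra)
  have K_sub: "K \<in> vimage_algebra (space M) Y S \<rightarrow>\<^sub>M subprob_algebra N"
    using K_meas by (rule measurable_prob_algebraD)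
  have D_Sigma: "(SIGMA \<omega>:space (vimage_algebra (space M) Y S). Pair \<omega> -` ?D) \<in> sets ?HN"
  proof -
    have "(SIGMA \<omega>:space (vimage_algebra (space M) Y S). Pair \<omega> -` ?D) = ?D"
      by (auto simp: space_pair_measure)
    then show ?thesis using D by simp
  qed
  have ev: "(\<lambda>\<omega>. emeasure (K \<omega>) (Pair \<omega> -` ?D)) \<in> borel_measurable M"
    using measurable_from_subalg[OF H emeasure_measurable_subprob_algebra2[OF D_Sigma K_sub]] .
  have "(\<integral>\<^sup>+\<omega>. emeasure (K \<omega>) (Pair \<omega> -` ?D) \<partial>M) = emeasure M {\<omega>\<in>space M. (\<omega>, X \<omega>) \<in> ?D}"
    by (rule regular_cond_law_disintegration[OF assms(1) X Y K D, symmetric])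
  also have "{\<omega>\<in>space M. (\<omega>, X \<omega>) \<in> ?D} = {\<omega>\<in>space M. \<not> P \<omega> (X \<omega>)}"
    using measurable_space[OF X] by (auto simp: space_pair_measure)
  also have "emeasure M \<dots> = 0"
    by (rule emeasure_eq_0_AE) (use AE in simp)
  finally have "AE \<omega> in M. emeasure (K \<omega>) (Pair \<omega> -` ?D) = 0"
    using nn_integral_0_iff_AE[OF ev] by simp
  then show ?thesis
    using AE_space
  proof eventually_elim
    case (elim \<omega>)
    have "Pair \<omega> -` ?D \<in> null_sets (K \<omega>)"
      using elim sets_Pair1[OF D] K_sets by auto
    then show ?case
      by (rule AE_I') (use elim sets_eq_imp_space_eq[OF K_sets] in \<open>auto simp: space_pair_measure\<close>)
  qed
qed

text \<open>At most \<open>1 / c\<close> points can have mass \<open>c\<close>, and together they carry the whole law.\<close>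

lemma uniform_law_on_if_AE_atoms_equal:
  assumes "prob_space \<mu>" and sets: "sets \<mu> = sets N" and c: "c > 0"
    and sing: "\<And>x. x \<in> space N \<Longrightarrow> {x} \<in> sets N"
    and AE: "AE x in \<mu>. measure \<mu> {x} = c"
  obtains F where "F \<subseteq> space N" "finite F" "F \<noteq> {}" "real (card F) * c = 1" "\<mu> = uniform_law_on N F"
proof -
  interpret prob_space \<mu> by fact
  have space: "space \<mu> = space N" using sets by (rule sets_eq_imp_space_eq)
  define F where "F = {x\<in>space N. measure \<mu> {x} = c}"
  have fin_sum: "measure \<mu> S = real (card S) * c" if "finite S" "S \<subseteq> F" for S
  proof -
    have "measure \<mu> S = (\<Sum>x\<in>S. measure \<mu> {x})"
      using that sing sets by (intro measure_eq_sum_singleton) (auto simp: F_def)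
    also have "\<dots> = real (card S) * c" using that by (auto simp: F_def subset_iff)
    finally show ?thesis .
  qed
  have fin: "finite F"
  proof (rule ccontr)
    assume "infinite F"
    obtain n :: nat where n: "real n * c > 1" using c reals_Archimedean3 by blast
    obtain S where S: "S \<subseteq> F" "finite S" "card S = n"
      using infinite_arbitrarily_large[OF \<open>infinite F\<close>] by blast
    then show False using fin_sum[of S] n prob_le_1[of S] by simp
  qed
  have meas_fin: "S \<in> sets \<mu>" if "S \<subseteq> F" for S
  proof -
    have "(\<Union>x\<in>S. {x}) \<in> sets \<mu>"
      using finite_subset[OF that fin] that sing sets by (intro sets.finite_UN) (auto simp: F_def)
    then show ?thesis by simp
  qed
  have AEF: "AE x in \<mu>. x \<in> F"
    using AE AE_space by eventually_elim (simp add: F_def space)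
  then have one: "measure \<mu> F = 1"
    using meas_fin by (simp add: AE_in_set_eq_1)
  then have card: "real (card F) * c = 1" using fin_sum[OF fin] by simp
  then have ne: "F \<noteq> {}" by auto
  have "\<mu> = uniform_law_on N F"
  proof (rule measure_eqI)
    show "sets \<mu> = sets (uniform_law_on N F)" by (simp add: uniform_law_on_def sets)
    fix B assume B: "B \<in> sets \<mu>"
    have "emeasure \<mu> B = emeasure \<mu> (B \<inter> F)"
      by (rule emeasure_eq_AE) (use AEF B meas_fin in auto)
    also have "\<dots> = ennreal (real (card (B \<inter> F)) * c)"
      using fin_sum[of "B \<inter> F"] fin by (simp add: emeasure_eq_measure)
    also have "\<dots> = ennreal (real (card (B \<inter> F)) / real (card F))"
    proof -
      have "c = 1 / real (card F)" using card fin ne by (simp add: nonzero_eq_divide_eq mult.commute)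
      then show ?thesis by simp
    qed
    also have "\<dots> = emeasure (uniform_count_measure F) (B \<inter> F)"
      using fin by (simp add: emeasure_uniform_count_measure)
    also have "\<dots> = emeasure (uniform_law_on N F) B"
      unfolding uniform_law_on_def using B sets
      by (subst emeasure_distr)
        (auto simp: F_def sets_uniform_count_measure space_uniform_count_measure measurable_def)
    finally show "emeasure \<mu> B = emeasure (uniform_law_on N F) B" .
  qed
  moreover have "F \<subseteq> space N" by (auto simp: F_def)
  ultimately show thesis using that fin ne card by blast
qed

text \<open>A point of positive mass would belong to the exceptional null set.\<close>

lemma diffuse_if_AE_atoms_null:
  assumes "prob_space \<mu>" and sets: "sets \<mu> = sets N"
    and sing: "\<And>x. x \<in> space N \<Longrightarrow> {x} \<in> sets N"
    and AE: "AE x in \<mu>. measure \<mu> {x} \<le> 0"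
  shows "diffuse \<mu>"
  unfolding diffuse_def
proof
  interpret prob_space \<mu> by fact
  have space: "space \<mu> = space N" using sets by (rule sets_eq_imp_space_eq)
  fix x assume x: "x \<in> space \<mu>"
  show "emeasure \<mu> {x} = 0"
  proof (rule ccontr)
    assume pos: "emeasure \<mu> {x} \<noteq> 0"
    obtain Z where Z: "{y\<in>space \<mu>. \<not> measure \<mu> {y} \<le> 0} \<subseteq> Z" "emeasure \<mu> Z = 0" "Z \<in> sets \<mu>"
      using AE by (rule AE_E)
    have "\<not> measure \<mu> {x} \<le> 0" using pos by (metis emeasure_eq_measure ennreal_neg)
    then have "x \<in> Z" using Z(1) x by auto
    then have "emeasure \<mu> {x} \<le> emeasure \<mu> Z" using Z(3) by (intro emeasure_mono) auto
    then show False using Z(2) pos by simp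
  qed
qed

section \<open>Sequences of signs\<close>

definition coordinate_field :: "'a measure \<Rightarrow> (int \<Rightarrow> 'a \<Rightarrow> int) \<Rightarrow> int set \<Rightarrow> 'a measure"
  where "coordinate_field M Z I =
    sigma (space M) (\<Union>k\<in>I. {Z k -` B \<inter> space M | B. B \<in> sets coin})"

lemma space_coordinate_field [simp]: "space (coordinate_field M Z I) = space M"
  by (simp add: coordinate_field_def space_measure_of_conv)

lemma sets_coordinate_field:
  "sets (coordinate_field M Z I) =
    sigma_sets (space M) (\<Union>k\<in>I. {Z k -` B \<inter> space M | B. B \<in> sets coin})"
  unfolding coordinate_field_def by (rule sets_measure_of) auto

lemma measurable_coordinate_field:
  assumes "k \<in> I" "Z k \<in> space M \<rightarrow> {-1, 1}"
  shows "Z k \<in> coordinate_field M Z I \<rightarrow>\<^sub>M coin"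
proof (rule measurableI)
  fix B assume "B \<in> sets coin"
  then show "Z k -` B \<inter> space (coordinate_field M Z I) \<in> sets (coordinate_field M Z I)"
    using assms(1) by (auto simp: sets_coordinate_field intro!: sigma_sets.Basic)
qed (use assms(2) in auto)

lemma subalgebra_coordinate_field:
  assumes "\<And>k. k \<in> I \<Longrightarrow> Z k \<in> N \<rightarrow>\<^sub>M coin" "space N = space M"
  shows "subalgebra N (coordinate_field M Z I)"
proof -
  have "sigma_sets (space N) (\<Union>k\<in>I. {Z k -` B \<inter> space M | B. B \<in> sets coin}) \<subseteq> sets N"
    using measurable_sets[OF assms(1)] assms(2) by (intro sets.sigma_sets_subset) auto
  then show ?thesis
    using assms(2) by (simp add: subalgebra_def sets_coordinate_field)
qed

lemma measurable_coin_mult: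
  assumes [measurable]: "f \<in> N \<rightarrow>\<^sub>M coin" "g \<in> N \<rightarrow>\<^sub>M coin"
  shows "(\<lambda>\<omega>. f \<omega> * g \<omega>) \<in> N \<rightarrow>\<^sub>M coin"
proof -
  have val: "f \<omega> = -1 \<or> f \<omega> = 1" "g \<omega> = -1 \<or> g \<omega> = 1" if "\<omega> \<in> space N" for \<omega>
    using measurable_space[OF assms(1) that] measurable_space[OF assms(2) that] by auto
  have fm: "f -` {s} \<inter> space N \<in> sets N" and gm: "g -` {s} \<inter> space N \<in> sets N" if "s \<in> {-1, 1}" for s
    using that by (auto intro!: measurable_sets[OF assms(1)] measurable_sets[OF assms(2)])
  have "(\<lambda>\<omega>. f \<omega> * g \<omega>) -` {s} \<inter> space N =
      (f -` {1} \<inter> space N) \<inter> (g -` {s} \<inter> space N) \<union> (f -` {-1} \<inter> space N) \<inter> (g -` {-s} \<inter> space N)" for s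
  proof (rule set_eqI)
    fix \<omega>
    show "\<omega> \<in> (\<lambda>\<omega>. f \<omega> * g \<omega>) -` {s} \<inter> space N \<longleftrightarrow>
      \<omega> \<in> (f -` {1} \<inter> space N) \<inter> (g -` {s} \<inter> space N) \<union> (f -` {-1} \<inter> space N) \<inter> (g -` {-s} \<inter> space N)"
      using val(1)[of \<omega>] by (cases "\<omega> \<in> space N") auto
  qed
  moreover have "(f -` {1} \<inter> space N) \<inter> (g -` {s} \<inter> space N) \<union> (f -` {-1} \<inter> space N) \<inter> (g -` {-s} \<inter> space N) \<in> sets N"
    if "s \<in> {-1, 1}" for s
    by (rule sets.Un[OF sets.Int[OF fm gm] sets.Int[OF fm gm]]) (use that in auto)
  ultimately have "(\<lambda>\<omega>. f \<omega> * g \<omega>) -` {s} \<inter> space N \<in> sets N" if "s \<in> {-1, 1}" for s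
    using that by (simp only:)
  moreover have "f \<omega> * g \<omega> \<in> {-1, 1}" if "\<omega> \<in> space N" for \<omega>
    using val[OF that] by (elim disjE) simp_all
  ultimately show ?thesis
    by (subst measurable_count_space_eq2) (simp, blast)
qed

lemma measurable_past:
  assumes "\<And>k. k \<le> n \<Longrightarrow> (\<lambda>\<omega>. x \<omega> k) \<in> N \<rightarrow>\<^sub>M coin"
  shows "(\<lambda>\<omega>. past (x \<omega>) n) \<in> N \<rightarrow>\<^sub>M one_sided"
  unfolding past_def one_sided_def
  by (rule measurable_restrict) (use assms in auto)

lemma measurable_two_sided_component: "(\<lambda>x. x k) \<in> two_sided \<rightarrow>\<^sub>M coin"
  unfolding two_sided_def by measurable

lemma measurable_into_two_sided:
  assumes "\<And>k. (\<lambda>\<omega>. f \<omega> k) \<in> N \<rightarrow>\<^sub>M coin"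
  shows "f \<in> N \<rightarrow>\<^sub>M two_sided"
proof -
  have "(\<lambda>\<omega>. \<lambda>k\<in>UNIV. f \<omega> k) \<in> N \<rightarrow>\<^sub>M two_sided"
    unfolding two_sided_def by (rule measurable_restrict) (rule assms)
  then show ?thesis by (simp add: restrict_def)
qed

lemma space_two_sided: "space two_sided = {x. \<forall>k. x k \<in> {-1, 1}}"
  by (auto simp: two_sided_def space_PiM PiE_def Pi_def)

lemma sets_eq_coin:
  assumes [measurable]: "f \<in> N \<rightarrow>\<^sub>M coin" "g \<in> N \<rightarrow>\<^sub>M coin"
  shows "{\<omega> \<in> space N. f \<omega> = g \<omega>} \<in> sets N"
proof -
  have "{\<omega> \<in> space N. f \<omega> = g \<omega>} = (\<lambda>\<omega>. f \<omega> * g \<omega>) -` {1} \<inter> space N"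
  proof (rule set_eqI)
    fix \<omega>
    show "\<omega> \<in> {\<omega> \<in> space N. f \<omega> = g \<omega>} \<longleftrightarrow> \<omega> \<in> (\<lambda>\<omega>. f \<omega> * g \<omega>) -` {1} \<inter> space N"
      using measurable_space[OF assms(1), of \<omega>] measurable_space[OF assms(2), of \<omega>]
      by (cases "\<omega> \<in> space N") auto
  qed
  then show ?thesis
    using measurable_sets[OF measurable_coin_mult[OF assms], of "{1}"] by simp
qed

lemma sets_eq_two_sided:
  fixes f g :: "'b \<Rightarrow> int \<Rightarrow> int"
  assumes "\<And>k. (\<lambda>\<omega>. f \<omega> k) \<in> N \<rightarrow>\<^sub>M coin" "\<And>k. (\<lambda>\<omega>. g \<omega> k) \<in> N \<rightarrow>\<^sub>M coin"
  shows "{\<omega> \<in> space N. f \<omega> = g \<omega>} \<in> sets N"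
proof -
  have "{\<omega> \<in> space N. f \<omega> = g \<omega>} = {\<omega> \<in> space N. \<forall>k. f \<omega> k = g \<omega> k}"
    by (auto simp: fun_eq_iff)
  also have "\<dots> \<in> sets N"
    by (intro sets.sets_Collect_countable_All sets_eq_coin assms)
  finally show ?thesis .
qed

definition cylinder :: "int \<Rightarrow> int \<Rightarrow> (int \<Rightarrow> int) \<Rightarrow> (int \<Rightarrow> int) set"
  where "cylinder m n s = {x \<in> space two_sided. \<forall>k\<in>{m..n}. x k = s k}"

lemma sets_cylinder:
  assumes "\<And>k. k \<in> {m..n} \<Longrightarrow> s k \<in> {-1, 1}"
  shows "cylinder m n s \<in> sets two_sided"
  unfolding cylinder_def
proof (rule sets.sets_Collect_finite_All)
  show "{x \<in> space two_sided. x k = s k} \<in> sets two_sided" if "k \<in> {m..n}" for k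
  proof (rule sets_eq_coin[OF measurable_two_sided_component])
    show "(\<lambda>x. s k) \<in> two_sided \<rightarrow>\<^sub>M coin"
      using assms[OF that] by (intro measurable_const) simp
  qed
qed simp

text \<open>The output and the remote past of the input determine the input: the signs \<open>h n\<close> never vanish,
  so each next coordinate can be read off from the output and the coordinates before it.\<close>

lemma eq_if_same_past_and_Phi:
  assumes h: "\<And>n. h n \<in> one_sided \<rightarrow>\<^sub>M coin"
    and x: "x \<in> space two_sided" "x' \<in> space two_sided"
    and past: "\<And>k. k \<le> n \<Longrightarrow> x k = x' k" and Phi: "Phi h x = Phi h x'"
  shows "x = x'"
proof
  fix k
  have same: "\<forall>j\<le>n + int i. x j = x' j" for i
  proof (induction i)
    case 0
    then show ?case using past by simp
  next
    case (Suc i)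
    define l where "l = n + int (Suc i)"
    have "past x (l - 1) = past x' (l - 1)"
      using Suc.IH by (auto simp: past_def l_def fun_eq_iff)
    moreover have "h l (past x (l - 1)) \<noteq> 0"
    proof -
      have "past x (l - 1) \<in> space one_sided"
        using x(1) by (auto simp: past_def one_sided_def space_PiM space_two_sided)
      then show ?thesis using measurable_space[OF h, of "past x (l - 1)" l] by auto
    qed
    moreover have "h l (past x (l - 1)) * x l = h l (past x' (l - 1)) * x' l"
      using Phi by (auto simp: Phi_def dest: fun_cong[of _ _ l])
    ultimately have "x l = x' l" by simp
    then show ?case using Suc.IH by (metis l_def of_nat_Suc add.assoc add.commute zle_add1_eq_le order_le_less)
  qed
  show "x k = x' k"
    using same[of "nat (k - n)"] by auto
qed

section \<open>Input and output of a past-dependent change of signs\<close>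

locale past_dependent_flip = prob_space M for M :: "'a measure" +
  fixes \<epsilon> :: "int \<Rightarrow> 'a \<Rightarrow> int" and h :: "int \<Rightarrow> (int \<Rightarrow> int) \<Rightarrow> int"
  assumes coin: "coin_tossing M \<epsilon>"
    and h: "\<And>n. h n \<in> one_sided \<rightarrow>\<^sub>M coin"
begin

definition X :: "'a \<Rightarrow> int \<Rightarrow> int"
  where "X \<omega> = (\<lambda>n. \<epsilon> n \<omega>)"

definition Y :: "'a \<Rightarrow> int \<Rightarrow> int"
  where "Y \<omega> = Phi h (X \<omega>)"

abbreviation \<eta> :: "int \<Rightarrow> 'a \<Rightarrow> int"
  where "\<eta> k \<omega> \<equiv> Y \<omega> k"

abbreviation \<F> :: "int \<Rightarrow> 'a measure"
  where "\<F> n \<equiv> coordinate_field M \<epsilon> {..n}"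

abbreviation \<G> :: "int \<Rightarrow> 'a measure"
  where "\<G> n \<equiv> coordinate_field M \<eta> {..n}"

abbreviation \<Y> :: "'a measure"
  where "\<Y> \<equiv> vimage_algebra (space M) Y two_sided"

lemma eps_measurable: "\<epsilon> n \<in> M \<rightarrow>\<^sub>M coin"
  and eps_indep: "indep_sets (\<lambda>k. {\<epsilon> k -` B \<inter> space M | B. B \<in> sets coin}) UNIV"
  using coin by (auto simp: coin_tossing_def indep_vars_def2)

lemma eps_values: "\<omega> \<in> space M \<Longrightarrow> \<epsilon> n \<omega> = -1 \<or> \<epsilon> n \<omega> = 1"
  using measurable_space[OF eps_measurable, of \<omega> n] by auto

lemma X_measurable: "X \<in> M \<rightarrow>\<^sub>M two_sided"
  unfolding X_def by (rule measurable_into_two_sided) (rule eps_measurable)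

lemma X_space: "\<omega> \<in> space M \<Longrightarrow> X \<omega> \<in> space two_sided"
  using measurable_space[OF X_measurable] .

lemma prob_eps: "E \<subseteq> {-1, 1} \<Longrightarrow> prob (\<epsilon> n -` E \<inter> space M) = real (card E) / 2"
proof -
  assume E: "E \<subseteq> {-1, 1}"
  have "prob (\<epsilon> n -` E \<inter> space M) = measure (distr M coin (\<epsilon> n)) E"
    using E by (intro measure_distr[symmetric] eps_measurable) simp
  also have "\<dots> = measure (uniform_count_measure {-1, 1 :: int}) E"
    using coin by (simp add: coin_tossing_def)
  also have "\<dots> = real (card E) / 2"
    using E by (subst measure_uniform_count_measure) auto
  finally show ?thesis .
qed

lemma F_subalgebra: "subalgebra M (\<F> n)"
  by (rule subalgebra_coordinate_field) (simp_all add: eps_measurable)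

lemma F_mono: "m \<le> n \<Longrightarrow> sets (\<F> m) \<subseteq> sets (\<F> n)"
  unfolding sets_coordinate_field by (rule sigma_sets_mono', rule UN_mono) simp_all

lemma eps_F_measurable: "k \<le> n \<Longrightarrow> \<epsilon> k \<in> \<F> n \<rightarrow>\<^sub>M coin"
  using eps_values by (intro measurable_coordinate_field) auto

lemma h_past_F_measurable: "(\<lambda>\<omega>. h k (past (X \<omega>) (k - 1))) \<in> \<F> (k - 1) \<rightarrow>\<^sub>M coin"
  using measurable_past[of "k - 1" X "\<F> (k - 1)"] eps_F_measurable
  by (intro measurable_compose[OF _ h]) (simp add: X_def)

lemma h_past_values: "\<omega> \<in> space M \<Longrightarrow> h k (past (X \<omega>) (k - 1)) = -1 \<or> h k (past (X \<omega>) (k - 1)) = 1"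
  using measurable_space[OF h_past_F_measurable, of \<omega> k] by simp

lemma Phi_measurable: "(\<lambda>x. Phi h x k) \<in> two_sided \<rightarrow>\<^sub>M coin"
  unfolding Phi_def
  by (intro measurable_coin_mult measurable_compose[OF _ h] measurable_past measurable_two_sided_component)

lemma eta_F_measurable:
  assumes "k \<le> n" shows "\<eta> k \<in> \<F> n \<rightarrow>\<^sub>M coin"
proof -
  have "subalgebra (\<F> n) (\<F> (k - 1))"
    using F_mono[of "k - 1" n] assms by (auto simp: subalgebra_def)
  from measurable_from_subalg[OF this h_past_F_measurable] show ?thesis
    unfolding Y_def Phi_def using assms
    by (intro measurable_coin_mult) (simp_all add: X_def eps_F_measurable)
qed

lemma eta_measurable: "\<eta> k \<in> M \<rightarrow>\<^sub>M coin"
  using measurable_from_subalg[OF F_subalgebra eta_F_measurable[OF order_refl]] .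

lemma Y_measurable: "Y \<in> M \<rightarrow>\<^sub>M two_sided"
  by (rule measurable_into_two_sided) (rule eta_measurable)

lemma Y_space: "\<omega> \<in> space M \<Longrightarrow> Y \<omega> \<in> space two_sided"
  using measurable_space[OF Y_measurable] .

lemma eta_Y_measurable: "\<eta> k \<in> \<Y> \<rightarrow>\<^sub>M coin"
proof -
  have "Y \<in> space M \<rightarrow> space two_sided" using Y_space by blast
  then have "Y \<in> \<Y> \<rightarrow>\<^sub>M two_sided"
    by (rule measurable_vimage_algebra1)
  from measurable_compose[OF this measurable_two_sided_component[of k]] show ?thesis .
qed

lemma eps_step_indep:
  assumes D: "D \<in> sets (\<F> (k - 1))" and E: "E \<subseteq> {-1, 1}"
  shows "prob (D \<inter> (\<epsilon> k -` E \<inter> space M)) = prob D * (real (card E) / 2)"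
proof -
  let ?A = "\<lambda>k. {\<epsilon> k -` B \<inter> space M | B. B \<in> sets coin}"
  let ?I = "\<lambda>b. if b then {..k - 1} else {k}"
  have indep: "indep_sets (\<lambda>b. sigma_sets (space M) (\<Union>i\<in>?I b. ?A i)) UNIV"
  proof (rule indep_sets_collect_sigma)
    show "indep_sets ?A (\<Union>b\<in>UNIV. ?I b)"
      using eps_indep by (rule indep_sets_mono_index[rotated]) simp
    show "Int_stable (?A i)" for i
    proof (rule Int_stableI)
      fix a b assume "a \<in> ?A i" "b \<in> ?A i"
      then obtain B B' where B: "B \<in> sets coin" "B' \<in> sets coin"
        and ab: "a = \<epsilon> i -` B \<inter> space M" "b = \<epsilon> i -` B' \<inter> space M" by blast
      have "a \<inter> b = \<epsilon> i -` (B \<inter> B') \<inter> space M" using ab by auto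
      then show "a \<inter> b \<in> ?A i" using sets.Int[OF B] by blast
    qed
    show "disjoint_family_on ?I UNIV"
      by (auto simp: disjoint_family_on_def)
  qed
  have "\<epsilon> k -` E \<inter> space M \<in> sigma_sets (space M) (\<Union>i\<in>?I False. ?A i)"
    using E by (intro sigma_sets.Basic) auto
  then have mem: "\<forall>b\<in>UNIV. (if b then D else \<epsilon> k -` E \<inter> space M) \<in> sigma_sets (space M) (\<Union>i\<in>?I b. ?A i)"
    using D by (simp add: sets_coordinate_field)
  have "prob (\<Inter>b\<in>UNIV. if b then D else \<epsilon> k -` E \<inter> space M) =
      (\<Prod>b\<in>UNIV. prob (if b then D else \<epsilon> k -` E \<inter> space M))"
    by (rule indep_setsD[OF indep _ _ _ mem]) simp_all
  then have "prob (D \<inter> (\<epsilon> k -` E \<inter> space M)) = prob D * prob (\<epsilon> k -` E \<inter> space M)"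
    by (simp add: UNIV_bool Int_commute mult.commute)
  then show ?thesis using prob_eps[OF E] by simp
qed

text \<open>The sign by which \<open>\<epsilon> k\<close> is multiplied is known at time \<open>k - 1\<close>, and the law of \<open>\<epsilon> k\<close> is symmetric:
  conditioning on the sign changes \<open>E\<close> into \<open>- E\<close>, which has the same probability.\<close>

lemma eta_step_indep:
  assumes D: "D \<in> sets (\<F> (k - 1))" and E: "E \<subseteq> {-1, 1}"
  shows "prob (D \<inter> (\<eta> k -` E \<inter> space M)) = prob D * (real (card E) / 2)"
proof -
  define H where "H s = (\<lambda>\<omega>. h k (past (X \<omega>) (k - 1))) -` {s} \<inter> space M" for s
  define U where "U B = \<epsilon> k -` B \<inter> space M" for B
  have H: "H s \<in> sets (\<F> (k - 1))" if "s \<in> {-1, 1}" for s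
    using measurable_sets[OF h_past_F_measurable, of "{s}"] that by (simp add: H_def)
  have H_disj: "H 1 \<inter> H (-1) = {}" by (auto simp: H_def)
  have H_cover: "H 1 \<union> H (-1) = space M" using h_past_values by (auto simp: H_def)
  have FM: "sets (\<F> (k - 1)) \<subseteq> events" using F_subalgebra by (simp add: subalgebra_def)
  have D_sub: "D \<subseteq> space M" using sets.sets_into_space[OF D] by simp
  have neg: "uminus ` E \<subseteq> {-1, 1}" "card (uminus ` E) = card E"
    using E by (auto simp: card_image)
  have U: "U B \<in> events" if "B \<subseteq> {-1, 1}" for B
    using measurable_sets[OF eps_measurable, of B] that by (simp add: U_def)
  have D1: "D \<inter> H 1 \<in> sets (\<F> (k - 1))" and D2: "D \<inter> H (-1) \<in> sets (\<F> (k - 1))"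
    using D H by auto
  have "D \<inter> (\<eta> k -` E \<inter> space M) = (D \<inter> H 1 \<inter> U E) \<union> (D \<inter> H (-1) \<inter> U (uminus ` E))"
  proof (rule set_eqI)
    fix \<omega>
    have neg_iff: "x \<in> uminus ` E \<longleftrightarrow> - x \<in> E" for x
      by (metis image_iff minus_minus)
    have eta: "\<eta> k \<omega> = h k (past (X \<omega>) (k - 1)) * \<epsilon> k \<omega>"
      by (simp add: Y_def Phi_def X_def)
    show "\<omega> \<in> D \<inter> (\<eta> k -` E \<inter> space M) \<longleftrightarrow>
      \<omega> \<in> (D \<inter> H 1 \<inter> U E) \<union> (D \<inter> H (-1) \<inter> U (uminus ` E))"
    proof (cases "\<omega> \<in> space M")
      case True
      from h_past_values[OF True, of k] show ?thesis
        by (elim disjE) (simp_all add: eta neg_iff True H_def U_def)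
    qed (simp add: H_def)
  qed
  also have "prob \<dots> = prob (D \<inter> H 1 \<inter> U E) + prob (D \<inter> H (-1) \<inter> U (uminus ` E))"
  proof (rule finite_measure_Union)
    show "D \<inter> H 1 \<inter> U E \<in> events" 
      using subsetD[OF FM D1] U[OF E] by (rule sets.Int)
    show "D \<inter> H (-1) \<inter> U (uminus ` E) \<in> events"
      using subsetD[OF FM D2] U[OF neg(1)] by (rule sets.Int)
    show "(D \<inter> H 1 \<inter> U E) \<inter> (D \<inter> H (-1) \<inter> U (uminus ` E)) = {}"
      using H_disj by blast
  qed
  also have "\<dots> = (prob (D \<inter> H 1) + prob (D \<inter> H (-1))) * (real (card E) / 2)"
    using eps_step_indep[OF D1 E] eps_step_indep[OF D2 neg(1)]
    by (simp add: neg(2) U_def distrib_right)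
  also have "prob (D \<inter> H 1) + prob (D \<inter> H (-1)) = prob ((D \<inter> H 1) \<union> (D \<inter> H (-1)))"
    using subsetD[OF FM D1] subsetD[OF FM D2] H_disj by (intro finite_measure_Union[symmetric]) blast+
  also have "(D \<inter> H 1) \<union> (D \<inter> H (-1)) = D"
    using D_sub H_cover by blast
  finally show ?thesis .
qed

text \<open>The output after time \<open>n\<close> is fresh with respect to the input up to time \<open>n\<close>: the latest
  coordinate is peeled off by the one-step independence, the earlier ones being part of the history.\<close>

lemma eta_future_indep:
  assumes "finite J" "J \<subseteq> {n<..}" "\<And>j. j \<in> J \<Longrightarrow> E j \<subseteq> {-1, 1}" "D \<in> sets (\<F> n)"
  shows "prob (D \<inter> {\<omega>\<in>space M. \<forall>j\<in>J. \<eta> j \<omega> \<in> E j}) =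
    prob D * prob {\<omega>\<in>space M. \<forall>j\<in>J. \<eta> j \<omega> \<in> E j}"
proof -
  have *: "prob (D \<inter> {\<omega>\<in>space M. \<forall>j\<in>J. \<eta> j \<omega> \<in> E j}) = prob D * (\<Prod>j\<in>J. real (card (E j)) / 2)"
    if "D \<in> sets (\<F> n)" for D
    using assms(1-3) that
  proof (induction J rule: finite_linorder_max_induct)
    case empty
    then show ?case using sets.sets_into_space[OF empty(3)] by (simp add: Int_absorb2)
  next
    case (insert b J)
    let ?B = "{\<omega>\<in>space M. \<forall>j\<in>J. \<eta> j \<omega> \<in> E j}"
    have B: "?B \<in> sets (\<F> (b - 1))"
    proof -
      have "{\<omega>\<in>space (\<F> (b - 1)). \<eta> j \<omega> \<in> E j} \<in> sets (\<F> (b - 1))" if "j \<in> J" for j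
      proof -
        have "\<eta> j -` E j \<inter> space (\<F> (b - 1)) \<in> sets (\<F> (b - 1))"
          using insert.hyps(2) insert.prems(2) that
          by (intro measurable_sets[OF eta_F_measurable]) auto
        then show ?thesis by (simp add: vimage_def Int_def conj_commute)
      qed
      then have "{\<omega>\<in>space (\<F> (b - 1)). \<forall>j\<in>J. \<eta> j \<omega> \<in> E j} \<in> sets (\<F> (b - 1))"
        using insert.hyps(1) by (intro sets.sets_Collect_finite_All) auto
      then show ?thesis by simp
    qed
    have "D \<in> sets (\<F> (b - 1))"
      using insert.prems(1,3) F_mono[of n "b - 1"] by auto
    then have DB: "D \<inter> ?B \<in> sets (\<F> (b - 1))" using B by auto
    have "D \<inter> {\<omega>\<in>space M. \<forall>j\<in>insert b J. \<eta> j \<omega> \<in> E j} = (D \<inter> ?B) \<inter> (\<eta> b -` E b \<inter> space M)"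
      by auto
    then have "prob (D \<inter> {\<omega>\<in>space M. \<forall>j\<in>insert b J. \<eta> j \<omega> \<in> E j}) =
        prob (D \<inter> ?B) * (real (card (E b)) / 2)"
      using eta_step_indep[OF DB, of "E b"] insert.prems(2) by simp
    also have "prob (D \<inter> ?B) = prob D * (\<Prod>j\<in>J. real (card (E j)) / 2)"
      using insert.prems by (intro insert.IH) auto
    finally show ?case
      using insert.hyps by (subst prod.insert) auto
  qed
  have "prob {\<omega>\<in>space M. \<forall>j\<in>J. \<eta> j \<omega> \<in> E j} = (\<Prod>j\<in>J. real (card (E j)) / 2)"
    using *[of "space M"] sets.top[of "\<F> n"] by (simp add: prob_space Int_absorb1 Collect_conj_eq)
  then show ?thesis using *[OF assms(4)] by simp
qed

text \<open>The generating cylinders of the output field split at time \<open>n\<close> into a part in \<open>\<G> n\<close> and a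
  part independent of \<open>\<F> n\<close>.\<close>

lemma cond_exp_output_eq_cond_exp_past:
  fixes f :: "'a \<Rightarrow> real"
  assumes f: "f \<in> borel_measurable (\<F> n)" "integrable M f"
  shows "AE \<omega> in M. real_cond_exp M \<Y> f \<omega> = real_cond_exp M (\<G> n) f \<omega>"
proof -
  let ?P = "{Y -` C \<inter> space M | C. C \<in> prod_algebra UNIV (\<lambda>_. coin)}"
  show ?thesis
  proof (rule real_cond_exp_drop_independent[OF F_subalgebra _ _ _ _ _ _ _ f, where P = ?P])
    show "subalgebra (\<F> n) (\<G> n)"
      by (rule subalgebra_coordinate_field) (simp_all add: eta_F_measurable)
    show "subalgebra M \<Y>" using Y_measurable by (rule subalgebra_vimage_algebra)
    show "subalgebra \<Y> (\<G> n)"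
      by (rule subalgebra_coordinate_field) (simp_all add: eta_Y_measurable)
    have Y_fun: "Y \<in> space M \<rightarrow> (\<Pi>\<^sub>E n\<in>UNIV. space coin)"
      using Y_space by (auto simp: two_sided_def space_PiM)
    show "sets \<Y> = sigma_sets (space M) ?P"
      using sigma_sets_vimage_commute[OF Y_fun, of "prod_algebra UNIV (\<lambda>_. coin)"] Y_space
      by (subst sets_vimage_algebra2) (auto simp: two_sided_def sets_PiM)
    show "?P \<subseteq> Pow (space M)" by auto
    show "Int_stable ?P"
    proof (rule Int_stableI)
      fix a b assume "a \<in> ?P" "b \<in> ?P"
      then obtain C C' where C: "C \<in> prod_algebra UNIV (\<lambda>_. coin)" "C' \<in> prod_algebra UNIV (\<lambda>_. coin)"
        and ab: "a = Y -` C \<inter> space M" "b = Y -` C' \<inter> space M" by blast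
      have "C \<inter> C' \<in> prod_algebra UNIV (\<lambda>_. coin)"
        using Int_stableD[OF Int_stable_prod_algebra C] .
      moreover have "a \<inter> b = Y -` (C \<inter> C') \<inter> space M" using ab by auto
      ultimately show "a \<inter> b \<in> ?P" by blast
    qed
    fix C assume "C \<in> ?P"
    then obtain C' where C': "C' \<in> prod_algebra UNIV (\<lambda>_. coin)" and C: "C = Y -` C' \<inter> space M"
      by blast
    obtain J E where J: "C' = prod_emb UNIV (\<lambda>_. coin) J (Pi\<^sub>E J E)" "finite J"
      and E: "\<And>j. j \<in> J \<Longrightarrow> E j \<in> sets coin"
      using prod_algebraE[OF C'] by metis
    let ?Z = "\<lambda>J. {\<omega>\<in>space M. \<forall>j\<in>J. \<eta> j \<omega> \<in> E j}"
    have Z: "?Z I \<in> sets N" if "I \<subseteq> J" "\<And>j. j \<in> I \<Longrightarrow> \<eta> j \<in> N \<rightarrow>\<^sub>M coin" "space N = space M" for I N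
    proof -
      have "\<eta> j -` E j \<inter> space N \<in> sets N" if "j \<in> I" for j
        using E \<open>I \<subseteq> J\<close> that by (intro measurable_sets[OF \<open>\<And>j. j \<in> I \<Longrightarrow> \<eta> j \<in> N \<rightarrow>\<^sub>M coin\<close>]) auto
      then have "{\<omega>\<in>space N. \<forall>j\<in>I. \<eta> j \<omega> \<in> E j} \<in> sets N"
        using finite_subset[OF that(1) J(2)]
        by (intro sets.sets_Collect_finite_All) (auto simp: vimage_def Int_def conj_commute)
      then show ?thesis using that(3) by simp
    qed
    have "C = ?Z J"
      using Y_space unfolding C J(1)
      by (auto simp: prod_emb_def two_sided_def space_PiM PiE_iff)
    also have "\<dots> = ?Z (J \<inter> {..n}) \<inter> ?Z (J \<inter> {n<..})"
      by (auto, metis Int_iff atMost_iff greaterThan_iff linorder_not_less)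
    finally have "C = ?Z (J \<inter> {..n}) \<inter> ?Z (J \<inter> {n<..})" .
    moreover have "?Z (J \<inter> {..n}) \<in> sets (\<G> n)"
      using measurable_space[OF eta_measurable]
      by (intro Z) (auto intro!: measurable_coordinate_field)
    moreover have "?Z (J \<inter> {n<..}) \<in> events"
      by (rule Z) (auto simp: eta_measurable)
    moreover have "prob (D \<inter> ?Z (J \<inter> {n<..})) = prob D * prob (?Z (J \<inter> {n<..}))"
      if "D \<in> sets (\<F> n)" for D
      using J(2) E that by (intro eta_future_indep) auto
    ultimately show "\<exists>A\<in>sets (\<G> n). \<exists>B\<in>events. C = A \<inter> B \<and>
        (\<forall>D\<in>sets (\<F> n). prob (D \<inter> B) = prob D * prob B)"
      by blast
  qed
qed

section \<open>The mass of the true input\<close>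

context
  fixes K :: "'a \<Rightarrow> (int \<Rightarrow> int) measure"
  assumes K: "regular_cond_law M X two_sided Y two_sided K"
begin

lemma K_measurable: "K \<in> \<Y> \<rightarrow>\<^sub>M prob_algebra two_sided"
  and K_cond_exp: "B \<in> sets two_sided \<Longrightarrow>
    AE \<omega> in M. measure (K \<omega>) B = real_cond_exp M \<Y> (indicator (X -` B \<inter> space M)) \<omega>"
  using K by (auto simp: regular_cond_law_def)

lemma K_prob_space: "\<omega> \<in> space M \<Longrightarrow> prob_space (K \<omega>)"
  and sets_K: "\<omega> \<in> space M \<Longrightarrow> sets (K \<omega>) = sets two_sided"
  using measurable_space[OF K_measurable, of \<omega>] by (simp_all add: space_prob_algebra)

lemma AE_K_Phi_eq: "AE \<omega> in M. AE x in K \<omega>. Phi h x = Y \<omega>"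
proof (rule regular_cond_law_AE_AE[OF prob_space_axioms X_measurable Y_measurable K])
  show "{z \<in> space (\<Y> \<Otimes>\<^sub>M two_sided). Phi h (snd z) = Y (fst z)} \<in> sets (\<Y> \<Otimes>\<^sub>M two_sided)"
    by (intro sets_eq_two_sided measurable_compose[OF measurable_snd Phi_measurable]
        measurable_compose[OF measurable_fst eta_Y_measurable])
qed (simp add: Y_def)

text \<open>A version, measurable for the input up to time \<open>n\<close>, of the mass that the conditional law gives to
  the sequences agreeing with the true input between times \<open>m\<close> and \<open>n\<close>. Only the summand in which
  \<open>s\<close> is the true block can differ from zero.\<close>

definition past_mass :: "int \<Rightarrow> int \<Rightarrow> 'a \<Rightarrow> real"
  where "past_mass m n \<omega> = (\<Sum>s\<in>{m..n} \<rightarrow>\<^sub>E {-1, 1}. indicator (X -` cylinder m n s \<inter> space M) \<omega> *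
    real_cond_exp M (\<G> n) (indicator (X -` cylinder m n s \<inter> space M)) \<omega>)"

lemma sets_past_event:
  assumes "s \<in> {m..n} \<rightarrow>\<^sub>E {-1, 1}"
  shows "X -` cylinder m n s \<inter> space M \<in> sets (\<F> n)"
proof -
  have "X -` cylinder m n s \<inter> space M = {\<omega> \<in> space (\<F> n). \<forall>k\<in>{m..n}. \<epsilon> k \<omega> = s k}"
    using X_space by (auto simp: cylinder_def X_def)
  also have "\<dots> \<in> sets (\<F> n)"
  proof (rule sets.sets_Collect_finite_All)
    fix k assume k: "k \<in> {m..n}"
    show "{\<omega> \<in> space (\<F> n). \<epsilon> k \<omega> = s k} \<in> sets (\<F> n)"
      using k PiE_mem[OF assms k] by (intro sets_eq_coin eps_F_measurable measurable_const) auto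
  qed simp
  finally show ?thesis .
qed

lemma past_mass_measurable: "past_mass m n \<in> borel_measurable (\<F> n)"
  unfolding past_mass_def
proof (intro borel_measurable_sum borel_measurable_times)
  fix s assume s: "s \<in> {m..n} \<rightarrow>\<^sub>E {-1, 1 :: int}"
  show "(indicator (X -` cylinder m n s \<inter> space M) :: 'a \<Rightarrow> real) \<in> borel_measurable (\<F> n)"
    using sets_past_event[OF s] by simp
  have "subalgebra (\<F> n) (\<G> n)"
    by (rule subalgebra_coordinate_field) (simp_all add: eta_F_measurable)
  from measurable_from_subalg[OF this borel_measurable_cond_exp]
  show "real_cond_exp M (\<G> n) (indicator (X -` cylinder m n s \<inter> space M)) \<in> borel_measurable (\<F> n)" .
qed

text \<open>The times and the blocks are countably many, so a single null set serves for all of them, and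
  the block may then be chosen depending on \<open>\<omega>\<close>.\<close>

lemma AE_K_cylinder_eq_past_mass:
  "AE \<omega> in M. \<forall>m n. measure (K \<omega>) (cylinder m n (X \<omega>)) = past_mass m n \<omega>"
proof -
  let ?A = "\<lambda>m n s. X -` cylinder m n s \<inter> space M"
  have "AE \<omega> in M. measure (K \<omega>) (cylinder m n s) = real_cond_exp M (\<G> n) (indicator (?A m n s)) \<omega>"
    if s: "s \<in> {m..n} \<rightarrow>\<^sub>E {-1, 1}" for m n s
  proof -
    have ev: "?A m n s \<in> events"
      using sets_past_event[OF s] F_subalgebra[of n] by (auto simp: subalgebra_def)
    have "cylinder m n s \<in> sets two_sided"
      by (rule sets_cylinder) (use PiE_mem[OF s] in auto)
    from K_cond_exp[OF this]
    have "AE \<omega> in M. measure (K \<omega>) (cylinder m n s) = real_cond_exp M \<Y> (indicator (?A m n s)) \<omega>" .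
    moreover have "AE \<omega> in M. real_cond_exp M \<Y> (indicator (?A m n s)) \<omega> =
        real_cond_exp M (\<G> n) (indicator (?A m n s)) \<omega>"
      using sets_past_event[OF s] ev
      by (intro cond_exp_output_eq_cond_exp_past) (simp_all add: integrable_indicator_iff less_top[symmetric])
    ultimately show ?thesis by eventually_elim simp
  qed
  then have "AE \<omega> in M. \<forall>s\<in>{m..n} \<rightarrow>\<^sub>E {-1, 1}.
      measure (K \<omega>) (cylinder m n s) = real_cond_exp M (\<G> n) (indicator (?A m n s)) \<omega>" for m n
    by (intro AE_finite_allI finite_PiE) auto
  then have "AE \<omega> in M. \<forall>m n. \<forall>s\<in>{m..n} \<rightarrow>\<^sub>E {-1, 1}.
      measure (K \<omega>) (cylinder m n s) = real_cond_exp M (\<G> n) (indicator (?A m n s)) \<omega>"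
    by (simp add: AE_all_countable)
  then show ?thesis
    using AE_space
  proof eventually_elim
    case (elim \<omega>)
    show ?case
    proof (intro allI)
      fix m n
      define s\<^sub>0 where "s\<^sub>0 = restrict (X \<omega>) {m..n}"
      have s\<^sub>0: "s\<^sub>0 \<in> {m..n} \<rightarrow>\<^sub>E {-1, 1}"
        using X_space[OF elim(2)] by (auto simp: s\<^sub>0_def space_two_sided)
      have cyl: "cylinder m n (X \<omega>) = cylinder m n s\<^sub>0"
        by (auto simp: cylinder_def s\<^sub>0_def)
      have mem: "\<omega> \<in> ?A m n s \<longleftrightarrow> s = s\<^sub>0" if "s \<in> {m..n} \<rightarrow>\<^sub>E {-1, 1}" for s
      proof
        assume "\<omega> \<in> ?A m n s"
        then show "s = s\<^sub>0"
          using that s\<^sub>0 by (intro PiE_ext[OF that s\<^sub>0]) (simp add: cylinder_def s\<^sub>0_def)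
      qed (use elim(2) X_space in \<open>simp add: cylinder_def s\<^sub>0_def\<close>)
      have "past_mass m n \<omega> = (\<Sum>s\<in>{m..n} \<rightarrow>\<^sub>E {-1, 1}.
          if s = s\<^sub>0 then real_cond_exp M (\<G> n) (indicator (?A m n s\<^sub>0)) \<omega> else 0)"
        unfolding past_mass_def by (intro sum.cong refl) (simp add: mem indicator_def del: vimage_Int Int_iff)
      also have "\<dots> = real_cond_exp M (\<G> n) (indicator (?A m n s\<^sub>0)) \<omega>"
        using s\<^sub>0 by (simp add: finite_PiE)
      finally show "measure (K \<omega>) (cylinder m n (X \<omega>)) = past_mass m n \<omega>"
        using elim(1) s\<^sub>0 cyl by simp
    qed
  qed
qed

text \<open>Since the conditional law is carried by the sequences with output \<open>Y\<close>, agreeing with the true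
  input up to time \<open>n\<close> amounts to being the true input. Letting \<open>m\<close> tend to \<open>- \<infinity>\<close> thus gives
  the mass of the true input by quantities known at time \<open>n\<close>, whatever \<open>n\<close> is.\<close>

lemma AE_K_singleton_eq_lim_past_mass:
  "AE \<omega> in M. measure (K \<omega>) {X \<omega>} = lim (\<lambda>i. past_mass (n - int i) n \<omega>)"
  using AE_K_cylinder_eq_past_mass AE_K_Phi_eq AE_space
proof eventually_elim
  case (elim \<omega>)
  interpret K: prob_space "K \<omega>" using elim(3) by (rule K_prob_space)
  let ?C = "\<lambda>i. cylinder (n - int i) n (X \<omega>)"
  have C: "?C i \<in> sets (K \<omega>)" for i
    using X_space[OF elim(3)] by (simp add: sets_K[OF elim(3)] sets_cylinder space_two_sided)
  have "(\<lambda>i. measure (K \<omega>) (?C i)) \<longlonglongrightarrow> measure (K \<omega>) (\<Inter>i. ?C i)"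
    using C by (intro K.finite_Lim_measure_decseq) (auto simp: decseq_def cylinder_def)
  moreover have "measure (K \<omega>) (\<Inter>i. ?C i) = measure (K \<omega>) {X \<omega>}"
  proof (rule K.finite_measure_eq_AE)
    show "AE x in K \<omega>. x \<in> (\<Inter>i. ?C i) \<longleftrightarrow> x \<in> {X \<omega>}"
      using elim(2) 
    proof eventually_elim
      case (elim x)
      show ?case
      proof
        assume x: "x \<in> (\<Inter>i. ?C i)"
        have "x k = X \<omega> k" if "k \<le> n" for k
        proof -
          have "x \<in> ?C (nat (n - k))" using x by blast
          then show ?thesis using that by (simp add: cylinder_def)
        qed
        moreover have "x \<in> space two_sided" using x by (simp add: cylinder_def)
        ultimately have "x = X \<omega>"
          using elim X_space[OF \<open>\<omega> \<in> space M\<close>]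
          by - (rule eq_if_same_past_and_Phi[OF h, where n = n], simp_all add: Y_def)
        then show "x \<in> {X \<omega>}" by simp
      qed (use X_space[OF \<open>\<omega> \<in> space M\<close>] in \<open>simp add: cylinder_def\<close>)
    qed
    show "(\<Inter>i. ?C i) \<in> sets (K \<omega>)" using C by (intro sets.countable_INT) auto
    show "{X \<omega>} \<in> sets (K \<omega>)"
      using X_space[OF elim(3)] by (simp add: sets_K[OF elim(3)] sets_two_sided_singleton)
  qed
  ultimately have "(\<lambda>i. past_mass (n - int i) n \<omega>) \<longlonglongrightarrow> measure (K \<omega>) {X \<omega>}"
    using elim(1) by simp
  then show ?case by (rule limI[symmetric])
qed

text \<open>For every \<open>n\<close> the mass of the true input has a version that depends on the input up to time \<open>n\<close>
  only, so it is governed by the remote past of independent variables. Time is reversed so that this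
  past becomes the tail of a sequence indexed by the natural numbers.\<close>

lemma AE_K_singleton_const: "\<exists>c. AE \<omega> in M. measure (K \<omega>) {X \<omega>} = c"
proof (rule tail_measurable_AE_const)
  let ?A = "\<lambda>i::nat. {\<epsilon> (- int i) -` B \<inter> space M | B. B \<in> sets coin}"
  show "sigma_algebra (space M) (?A i)" for i
  proof -
    have "?A i = sets (vimage_algebra (space M) (\<epsilon> (- int i)) coin)"
      using eps_values by (subst sets_vimage_algebra2) auto
    then show ?thesis
      using sets.sigma_algebra_axioms[of "vimage_algebra (space M) (\<epsilon> (- int i)) coin"] by simp
  qed
  show "indep_sets ?A UNIV"
    using indep_sets_reindex[OF eps_indep, of "\<lambda>i::nat. - int i"] by (simp add: inj_on_def)
  show "AE \<omega> in M. measure (K \<omega>) {X \<omega>} = lim (\<lambda>i. past_mass (- int m - int i) (- int m) \<omega>)" for m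
    by (rule AE_K_singleton_eq_lim_past_mass)
  show "(\<lambda>\<omega>. lim (\<lambda>i. past_mass (- int m - int i) (- int m) \<omega>))
      \<in> borel_measurable (sigma (space M) (\<Union>i\<in>{m..}. ?A i))" for m
  proof -
    have "(\<lambda>i. - int i) ` {m..} = {..- int m}"
    proof -
      have "k \<in> (\<lambda>i. - int i) ` {m..}" if "k \<le> - int m" for k
        using that by (intro image_eqI[of _ _ "nat (- k)"]) auto
      then show ?thesis by auto
    qed
    moreover have "sigma (space M) (\<Union>i\<in>{m..}. ?A i) =
        coordinate_field M \<epsilon> ((\<lambda>i. - int i) ` {m..})"
      unfolding coordinate_field_def by (simp only: image_image)
    ultimately have "sigma (space M) (\<Union>i\<in>{m..}. ?A i) = \<F> (- int m)"
      by (simp only:)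
    then show ?thesis
      using past_mass_measurable by (simp add: borel_measurable_lim_metric)
  qed
qed

text \<open>Given the output, the true input is a typical point of its conditional law, so the mass of a typical
  point is the same constant.\<close>

lemma AE_K_atoms_equal: "\<exists>c. AE \<omega> in M. AE x in K \<omega>. measure (K \<omega>) {x} = c"
proof -
  obtain c where c: "AE \<omega> in M. measure (K \<omega>) {X \<omega>} = c"
    using AE_K_singleton_const by blast
  let ?HN = "\<Y> \<Otimes>\<^sub>M two_sided"
  have "AE \<omega> in M. AE x in K \<omega>. measure (K \<omega>) {x} = c"
  proof (rule regular_cond_law_AE_AE[where P = "\<lambda>\<omega> x. measure (K \<omega>) {x} = c",
        OF prob_space_axioms X_measurable Y_measurable K _ c])
    have "(SIGMA z:space ?HN. {snd z}) = {w \<in> space (?HN \<Otimes>\<^sub>M two_sided). snd w = snd (fst w)}"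
      by (auto simp: space_pair_measure)
    also have "\<dots> \<in> sets (?HN \<Otimes>\<^sub>M two_sided)"
      by (intro sets_eq_two_sided measurable_compose[OF _ measurable_two_sided_component]
          measurable_snd measurable_compose[OF measurable_fst measurable_snd])
    finally have "(\<lambda>z. measure (K (fst z)) {snd z}) \<in> borel_measurable ?HN"
      by (rule measure_measurable_prob_algebra2) (rule measurable_compose[OF measurable_fst K_measurable])
    then show "{z \<in> space ?HN. measure (K (fst z)) {snd z} = c} \<in> sets ?HN"
      by measurable
  qed
  then show ?thesis ..
qed

end

end

theorem theorem1:
  fixes M :: "'a measure"
    and \<epsilon> :: "int \<Rightarrow> 'a \<Rightarrow> int"
    and h :: "int \<Rightarrow> (int \<Rightarrow> int) \<Rightarrow> int"
    and K :: "'a \<Rightarrow> (int \<Rightarrow> int) measure"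
  assumes "prob_space M"
    and "coin_tossing M \<epsilon>"
    and "\<And>n. h n \<in> one_sided \<rightarrow>\<^sub>M coin"
    and "regular_cond_law M (\<lambda>\<omega> n. \<epsilon> n \<omega>) two_sided (\<lambda>\<omega>. Phi h (\<lambda>n. \<epsilon> n \<omega>)) two_sided K"
  shows "(AE \<omega> in M. diffuse (K \<omega>)) \<or>
    (\<exists>c. AE \<omega> in M. \<exists>F \<subseteq> space two_sided.
       finite F \<and> F \<noteq> {} \<and> card F = c \<and> K \<omega> = uniform_law_on two_sided F)"
proof -
  interpret prob_space M by fact
  interpret past_dependent_flip M \<epsilon> h
    by unfold_locales (use assms in auto)
  have K: "regular_cond_law M X two_sided Y two_sided K"
    using assms(4) by (simp add: X_def[abs_def] Y_def[abs_def])
  obtain c where c: "AE \<omega> in M. AE x in K \<omega>. measure (K \<omega>) {x} = c"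
    using AE_K_atoms_equal[OF K] by blast
  show ?thesis
  proof (cases "c > 0")
    case True
    have "AE \<omega> in M. \<exists>F \<subseteq> space two_sided. finite F \<and> F \<noteq> {} \<and>
        card F = nat \<lfloor>1 / c\<rfloor> \<and> K \<omega> = uniform_law_on two_sided F"
      using c AE_space
    proof eventually_elim
      case (elim \<omega>)
      obtain F where F: "F \<subseteq> space two_sided" "finite F" "F \<noteq> {}" "real (card F) * c = 1"
          "K \<omega> = uniform_law_on two_sided F"
        using uniform_law_on_if_AE_atoms_equal[OF K_prob_space[OF K elim(2)] sets_K[OF K elim(2)] True
            sets_two_sided_singleton elim(1)] by blast
      have "real (card F) = 1 / c" using F(4) True by (simp add: eq_divide_eq)
      \<comment> \<open>The rounding only serves to name the natural number \<open>1 / c\<close>.\<close>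
      then have "card F = nat \<lfloor>1 / c\<rfloor>" by (metis floor_of_nat nat_int)
      then show ?case using F by blast
    qed
    then show ?thesis by blast
  next
    case False
    have "AE \<omega> in M. diffuse (K \<omega>)"
      using c AE_space
    proof eventually_elim
      case (elim \<omega>)
      have "AE x in K \<omega>. measure (K \<omega>) {x} \<le> 0"
        using elim(1) by (rule eventually_mono) (use False in simp)
      with K_prob_space[OF K elim(2)] sets_K[OF K elim(2)] sets_two_sided_singleton
      show ?case by (rule diffuse_if_AE_atoms_null)
    qed
    then show ?thesis ..
  qed
qed

end
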